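(* Let $\mathbb{K}$ be a Hausdorff topological field, let $X$ and $Y$ be two sets, and endow $\mathbb{K}^X$ and $\mathbb{K}^Y$ with their product topologies. Then the sets $\mathcal{L}(\mathbb{K}^X,\mathbb{K}^Y)$ and $\mathbb{K}^{Y\times(X)}$ are equipotent. More precisely, the (injective) map $\mathcal{L}(\mathbb{K}^X,\mathbb{K}^Y)\to\mathbb{K}^{Y\times(X)}$, $\phi\mapsto M_{\phi}$, where $M_\phi(y,x)=\phi(\delta_x)(y)$ for $(y,x)\in Y\times X$, is onto.
   Context: A topological field is a (commutative) field with a topology for which negation, addition and multiplication are continuous and inversion is continuous on the nonzero elements. For a set $Z$, $\mathbb{K}^Z$ is the $\mathbb{K}$-vector space of all maps $Z\to\mathbb{K}$; its product topology is the coarsest topology making all the projections $f\mapsto f(z)$, $z\in Z$, continuous. $\mathcal{L}(\mathbb{K}^X,\mathbb{K}^Y)$ is the set of all continuous $\mathbb{K}$-linear maps from $\mathbb{K}^X$ to $\mathbb{K}^Y$. $\mathbb{K}^{Y\times(X)}$ is the set of all maps $M\colon Y\times X\to\mathbb{K}$ such that for each $y\in Y$ the set $\{x\in X\colon M(y,x)\neq 0\}$ is finite. For $x\in X$, $\delta_x\in\mathbb{K}^X$ is the map with $\delta_x(x)=1$ and $\delta_x(z)=0$ for $z\neq x$. The paper writes $M_\phi(y,x)=\langle\delta_y,\phi(\delta_x)\rangle$, where $\langle p,f\rangle=\sum_{y\in Y}p(y)f(y)$ for finitely supported $p$, so this equals $\phi(\delta_x)(y)$. *)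

theory Defs
  imports "HOL-Analysis.Analysis"
begin

class topological_field = field + topological_ab_group_add + topological_semigroup_mult +
  assumes tendsto_inverse_nonzero: "a \<noteq> 0 \<Longrightarrow> (inverse \<longlongrightarrow> inverse a) (at a within - {0})"

lemma continuous_on_inverse_nonzero:
  "continuous_on (- {0}) (inverse :: 'k \<Rightarrow> 'k::topological_field)"
  by (simp add: continuous_on_def tendsto_inverse_nonzero)

instance real_normed_field \<subseteq> topological_field
  by standard (auto intro!: tendsto_inverse tendsto_ident_at)

text \<open>
  For a set \<open>Z\<close>, the maps from \<open>Z\<close> to the field are represented by the extensional functions
  \<open>Z \<rightarrow>\<^sub>E UNIV\<close>, which are \<open>undefined\<close> outside \<open>Z\<close>. This makes equality of
  functions agree with equality on \<open>Z\<close>, and it is the carrier of the library's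
  \<^const>\<open>product_topology\<close>. Vector space operations on this carrier therefore have to be
  restricted to \<open>Z\<close>.
\<close>

abbreviation fun_space :: "'z set \<Rightarrow> ('z \<Rightarrow> 'k) set"
  where "fun_space Z \<equiv> Z \<rightarrow>\<^sub>E UNIV"

abbreviation power_topology :: "'z set \<Rightarrow> ('z \<Rightarrow> 'k::topological_space) topology"
  where "power_topology Z \<equiv> product_topology (\<lambda>_. euclidean) Z"

definition linear_between ::
    "'x set \<Rightarrow> 'y set \<Rightarrow> (('x \<Rightarrow> 'k::field) \<Rightarrow> ('y \<Rightarrow> 'k)) \<Rightarrow> bool"
  where "linear_between X Y \<phi> \<longleftrightarrow>
    (\<forall>f\<in>fun_space X. \<forall>g\<in>fun_space X.
      \<phi> (\<lambda>x\<in>X. f x + g x) = (\<lambda>y\<in>Y. \<phi> f y + \<phi> g y)) \<and>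
    (\<forall>c. \<forall>f\<in>fun_space X.
      \<phi> (\<lambda>x\<in>X. c * f x) = (\<lambda>y\<in>Y. c * \<phi> f y))"

text \<open>
  The maps themselves are extensional on \<open>fun_space X\<close> as well, so that the set below contains
  each continuous linear map exactly once.
\<close>

definition continuous_linear_maps ::
    "'x set \<Rightarrow> 'y set \<Rightarrow> (('x \<Rightarrow> 'k::topological_field) \<Rightarrow> ('y \<Rightarrow> 'k)) set"
  where "continuous_linear_maps X Y =
    {\<phi> \<in> fun_space X \<rightarrow>\<^sub>E fun_space Y.
      linear_between X Y \<phi> \<and> continuous_map (power_topology X) (power_topology Y) \<phi>}"

definition row_finite_matrices :: "'y set \<Rightarrow> 'x set \<Rightarrow> ('y \<times> 'x \<Rightarrow> 'k::zero) set"
  where "row_finite_matrices Y X =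
    {M \<in> fun_space (Y \<times> X). \<forall>y\<in>Y. finite {x \<in> X. M (y, x) \<noteq> 0}}"

definition delta :: "'x set \<Rightarrow> 'x \<Rightarrow> ('x \<Rightarrow> 'k::zero_neq_one)"
  where "delta X x = (\<lambda>z\<in>X. if z = x then 1 else 0)"

definition matrix_of_map ::
    "'x set \<Rightarrow> 'y set \<Rightarrow> (('x \<Rightarrow> 'k::zero_neq_one) \<Rightarrow> ('y \<Rightarrow> 'k)) \<Rightarrow> ('y \<times> 'x \<Rightarrow> 'k)"
  where "matrix_of_map X Y \<phi> = (\<lambda>(y, x)\<in>Y \<times> X. \<phi> (delta X x) y)"

end

theory Submission
  imports Defs
begin

text \<open>
  Everything rests on the fact that a continuous linear form \<open>p\<close> on \<open>\<K>\<^sup>X\<close> depends on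
  finitely many coordinates only. Since the field is Hausdorff, some neighbourhood \<open>U\<close> of \<open>0\<close>
  misses \<open>1\<close>. By continuity there is a finite \<open>F \<subseteq> X\<close> such that \<open>p f \<in> U\<close> whenever \<open>f\<close>
  vanishes on \<open>F\<close>. Such \<open>f\<close> form a subspace, so \<open>p\<close> maps them onto a subspace of the field, which
  is \<open>0\<close> because it does not contain \<open>1\<close>.

  Splitting \<open>f\<close> into its part on \<open>F\<close> and a part vanishing on \<open>F\<close> then gives
  \<open>p f = (\<Sum>x\<in>F. f x * p \<delta>\<^sub>x)\<close> (\<open>continuous_linear_finite_expansion\<close>). Applied to the
  coordinates of a continuous linear map \<open>\<phi>\<close>, this shows that the rows of its matrix are finite
  and that the matrix determines \<open>\<phi>\<close>. Conversely, a row-finite matrix acts on \<open>\<K>\<^sup>X\<close> by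
  finite sums in each coordinate, and these are continuous for the product topology.
\<close>

lemma linear_between_add:
  assumes "linear_between X Y \<phi>" "f \<in> fun_space X" "g \<in> fun_space X" "y \<in> Y"
  shows "\<phi> (\<lambda>x\<in>X. f x + g x) y = \<phi> f y + \<phi> g y"
  using assms by (simp add: linear_between_def)

lemma linear_between_scale:
  assumes "linear_between X Y \<phi>" "f \<in> fun_space X" "y \<in> Y"
  shows "\<phi> (\<lambda>x\<in>X. c * f x) y = c * \<phi> f y"
  using assms by (simp add: linear_between_def)

lemma linear_between_zero:
  assumes "linear_between X Y \<phi>" "y \<in> Y"
  shows "\<phi> (\<lambda>x\<in>X. 0) y = 0"
  using linear_between_scale[OF assms(1) _ assms(2), of "\<lambda>x\<in>X. 0" 0]
  by (simp cong: restrict_cong)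

lemma delta_in_fun_space: "delta X x \<in> fun_space X"
  by (simp add: delta_def)

text \<open>
  Only finite sums of delta functions are available to linearity alone, so the coordinates are
  split off one at a time and a remainder vanishing on the finite set is kept.
\<close>

lemma linear_split_finite_support:
  assumes "finite F" and "F \<subseteq> X" and lin: "linear_between X Y \<phi>"
    and f: "f \<in> fun_space X" and y: "y \<in> Y"
  shows "\<phi> f y = \<phi> (\<lambda>x\<in>X. if x \<in> F then 0 else f x) y + (\<Sum>x\<in>F. f x * \<phi> (delta X x) y)"
  using assms(1,2)
proof (induction F)
  case empty
  have "(\<lambda>x\<in>X. if x \<in> {} then 0 else f x) = f"
    using f by (auto simp: PiE_def extensional_restrict)
  then show ?case by simp
next
  case (insert a F)
  let ?rem = "\<lambda>G. \<lambda>x\<in>X. if x \<in> G then 0 else f x"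
  have "?rem F = (\<lambda>x\<in>X. ?rem (insert a F) x + (\<lambda>x\<in>X. f a * delta X a x) x)"
    using insert.hyps by (auto simp: delta_def restrict_def fun_eq_iff)
  then have "\<phi> (?rem F) y = \<phi> (?rem (insert a F)) y + \<phi> (\<lambda>x\<in>X. f a * delta X a x) y"
    using linear_between_add[OF lin _ _ y, of "?rem (insert a F)" "\<lambda>x\<in>X. f a * delta X a x"]
    by simp
  also have "\<phi> (\<lambda>x\<in>X. f a * delta X a x) y = f a * \<phi> (delta X a) y"
    by (rule linear_between_scale[OF lin delta_in_fun_space y])
  finally show ?case
    using insert by (simp add: algebra_simps)
qed

text \<open>
  The image of the subspace \<open>{f. f vanishes on F}\<close> under a coordinate of \<open>\<phi>\<close> is a subspace of the
  field, hence \<open>0\<close> as soon as it lies in a neighbourhood of \<open>0\<close> that omits \<open>1\<close>.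
\<close>

lemma continuous_linear_vanishes_off_finite:
  fixes \<phi> :: "('x \<Rightarrow> 'k::{topological_field, t2_space}) \<Rightarrow> ('y \<Rightarrow> 'k)"
  assumes lin: "linear_between X Y \<phi>"
    and cont: "continuous_map (power_topology X) (power_topology Y) \<phi>"
    and y: "y \<in> Y"
  shows "\<exists>F. finite F \<and> F \<subseteq> X \<and>
    (\<forall>f\<in>fun_space X. (\<forall>x\<in>F. f x = 0) \<longrightarrow> \<phi> f y = 0)"
proof -
  obtain U :: "'k set" where U: "open U" "0 \<in> U" "1 \<notin> U"
    using t1_space[of "0::'k" 1] by auto
  have "continuous_map (power_topology X) euclidean (\<lambda>f. \<phi> f y)"
    using cont y by (simp add: continuous_map_componentwise)
  then have "openin (power_topology X) {f \<in> topspace (power_topology X). \<phi> f y \<in> U}"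
    using U(1) by (intro openin_continuous_map_preimage) auto
  moreover have "(\<lambda>x\<in>X. 0) \<in> {f \<in> topspace (power_topology X). \<phi> f y \<in> U}"
    using U(2) linear_between_zero[OF lin y] by simp
  ultimately have "\<exists>W. finite {x \<in> X. W x \<noteq> topspace euclidean} \<and>
      (\<forall>x\<in>X. openin euclidean (W x)) \<and> (\<lambda>x\<in>X. 0) \<in> Pi\<^sub>E X W \<and>
      Pi\<^sub>E X W \<subseteq> {f \<in> topspace (power_topology X). \<phi> f y \<in> U}"
    unfolding openin_product_topology_alt by (rule bspec)
  then obtain W where W: "finite {x \<in> X. W x \<noteq> UNIV}" "(\<lambda>x\<in>X. 0) \<in> Pi\<^sub>E X W"
      "Pi\<^sub>E X W \<subseteq> {f \<in> topspace (power_topology X). \<phi> f y \<in> U}"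
    unfolding topspace_euclidean by (elim exE conjE)
  let ?F = "{x \<in> X. W x \<noteq> UNIV}"
  have "\<phi> f y = 0" if f: "f \<in> fun_space X" and zero: "\<forall>x\<in>?F. f x = 0" for f
  proof (rule ccontr)
    assume nz: "\<phi> f y \<noteq> 0"
    \<comment> \<open>Rescaling \<open>f\<close> so that its value becomes \<open>1\<close> does not leave the basic neighbourhood.\<close>
    let ?g = "\<lambda>x\<in>X. inverse (\<phi> f y) * f x"
    have "?g x \<in> W x" if "x \<in> X" for x
    proof (cases "W x = UNIV")
      case False
      then have "f x = 0" "0 \<in> W x" using zero W(2) that by (auto simp: PiE_iff)
      then show ?thesis using that by simp
    qed simp
    then have "?g \<in> Pi\<^sub>E X W" by auto
    then have "\<phi> ?g y \<in> U" using W(3) by blast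
    moreover have "\<phi> ?g y = 1"
      using linear_between_scale[OF lin f y] nz by simp
    ultimately show False using U(3) by simp
  qed
  then show ?thesis using W(1) by blast
qed

lemma continuous_linear_finite_expansion:
  fixes \<phi> :: "('x \<Rightarrow> 'k::{topological_field, t2_space}) \<Rightarrow> ('y \<Rightarrow> 'k)"
  assumes "\<phi> \<in> continuous_linear_maps X Y" and y: "y \<in> Y"
  obtains F where "finite F" "F \<subseteq> X" "\<And>x. x \<in> X - F \<Longrightarrow> \<phi> (delta X x) y = 0"
    "\<And>f. f \<in> fun_space X \<Longrightarrow> \<phi> f y = (\<Sum>x\<in>F. f x * \<phi> (delta X x) y)"
proof -
  have lin: "linear_between X Y \<phi>"
    and cont: "continuous_map (power_topology X) (power_topology Y) \<phi>"
    using assms by (auto simp: continuous_linear_maps_def)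
  obtain F where F: "finite F" "F \<subseteq> X"
    and van: "\<And>f. f \<in> fun_space X \<Longrightarrow> \<forall>x\<in>F. f x = 0 \<Longrightarrow> \<phi> f y = 0"
    using continuous_linear_vanishes_off_finite[OF lin cont y] by blast
  have "\<phi> (delta X x) y = 0" if "x \<in> X - F" for x
    using that F(2) by (intro van delta_in_fun_space) (auto simp: delta_def)
  moreover have "\<phi> f y = (\<Sum>x\<in>F. f x * \<phi> (delta X x) y)" if "f \<in> fun_space X" for f
  proof -
    have "\<phi> (\<lambda>x\<in>X. if x \<in> F then 0 else f x) y = 0"
      using F(2) by (intro van) auto
    then show ?thesis
      using linear_split_finite_support[OF F lin that y] by simp
  qed
  ultimately show thesis using F that by blast
qed

lemma matrix_of_map_apply:
  "x \<in> X \<Longrightarrow> y \<in> Y \<Longrightarrow> matrix_of_map X Y \<phi> (y, x) = \<phi> (delta X x) y"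
  by (simp add: matrix_of_map_def)

lemma matrix_of_map_row_finite:
  fixes \<phi> :: "('x \<Rightarrow> 'k::{topological_field, t2_space}) \<Rightarrow> ('y \<Rightarrow> 'k)"
  assumes \<phi>: "\<phi> \<in> continuous_linear_maps X Y"
  shows "matrix_of_map X Y \<phi> \<in> row_finite_matrices Y X"
proof -
  have "finite {x \<in> X. matrix_of_map X Y \<phi> (y, x) \<noteq> 0}" if y: "y \<in> Y" for y
  proof -
    obtain F where F: "finite F" "\<And>x. x \<in> X - F \<Longrightarrow> \<phi> (delta X x) y = 0"
      by (rule continuous_linear_finite_expansion[OF \<phi> y]) blast
    have "{x \<in> X. matrix_of_map X Y \<phi> (y, x) \<noteq> 0} \<subseteq> F"
      using F(2) y by (force simp: matrix_of_map_apply)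
    then show ?thesis
      using F(1) by (rule finite_subset)
  qed
  moreover have "matrix_of_map X Y \<phi> \<in> fun_space (Y \<times> X)"
    by (simp add: matrix_of_map_def)
  ultimately show ?thesis by (simp add: row_finite_matrices_def)
qed

lemma inj_on_matrix_of_map:
  "inj_on (matrix_of_map X Y)
    (continuous_linear_maps X Y :: (('x \<Rightarrow> 'k::{topological_field, t2_space}) \<Rightarrow> ('y \<Rightarrow> 'k)) set)"
proof (rule inj_onI)
  fix \<phi> \<psi> :: "('x \<Rightarrow> 'k) \<Rightarrow> ('y \<Rightarrow> 'k)"
  assume \<phi>: "\<phi> \<in> continuous_linear_maps X Y" and \<psi>: "\<psi> \<in> continuous_linear_maps X Y"
    and eq: "matrix_of_map X Y \<phi> = matrix_of_map X Y \<psi>"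
  have ext: "\<phi> \<in> fun_space X \<rightarrow>\<^sub>E fun_space Y" "\<psi> \<in> fun_space X \<rightarrow>\<^sub>E fun_space Y"
    using \<phi> \<psi> by (auto simp: continuous_linear_maps_def)
  have delta_eq: "\<phi> (delta X x) y = \<psi> (delta X x) y" if "x \<in> X" "y \<in> Y" for x y
    using eq matrix_of_map_apply[OF that] by metis
  have "\<phi> f y = \<psi> f y" if f: "f \<in> fun_space X" and y: "y \<in> Y" for f y
  proof -
    obtain F where F: "finite F" "F \<subseteq> X" "\<And>x. x \<in> X - F \<Longrightarrow> \<phi> (delta X x) y = 0"
      "\<phi> f y = (\<Sum>x\<in>F. f x * \<phi> (delta X x) y)"
      by (rule continuous_linear_finite_expansion[OF \<phi> y]) (use f in blast)
    obtain G where G: "finite G" "G \<subseteq> X" "\<And>x. x \<in> X - G \<Longrightarrow> \<psi> (delta X x) y = 0"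
      "\<psi> f y = (\<Sum>x\<in>G. f x * \<psi> (delta X x) y)"
      by (rule continuous_linear_finite_expansion[OF \<psi> y]) (use f in blast)
    \<comment> \<open>The two expansions may use different finite sets; both extend to the union by zero terms.\<close>
    have "\<phi> f y = (\<Sum>x\<in>F \<union> G. f x * \<phi> (delta X x) y)"
      unfolding F(4) using F(1,3) G(1,2) by (intro sum.mono_neutral_left) auto
    also have "\<dots> = (\<Sum>x\<in>F \<union> G. f x * \<psi> (delta X x) y)"
      using F(2) G(2) y by (intro sum.cong) (auto simp: delta_eq)
    also have "\<dots> = \<psi> f y"
      unfolding G(4) using F(1,2) G(1,3) by (intro sum.mono_neutral_right) auto
    finally show ?thesis .
  qed
  then have "\<phi> f = \<psi> f" if "f \<in> fun_space X" for f
    using that ext by (intro PiE_ext[of "\<phi> f" Y _ "\<psi> f"]) auto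
  then show "\<phi> = \<psi>"
    by (intro PiE_ext[OF ext])
qed

text \<open>
  Summing over the support of a row rather than over \<open>X\<close> keeps the sum finite for row-finite
  matrices when \<open>X\<close> is infinite. A row with infinite support acts as \<open>0\<close>, by the
  convention for infinite index sets.
\<close>

definition map_of_matrix ::
    "'x set \<Rightarrow> 'y set \<Rightarrow> ('y \<times> 'x \<Rightarrow> 'k::field) \<Rightarrow> ('x \<Rightarrow> 'k) \<Rightarrow> ('y \<Rightarrow> 'k)"
  where "map_of_matrix X Y M =
    (\<lambda>f\<in>fun_space X. \<lambda>y\<in>Y. \<Sum>x | x \<in> X \<and> M (y, x) \<noteq> 0. M (y, x) * f x)"

lemma map_of_matrix_linear: "linear_between X Y (map_of_matrix X Y M)"
  by (auto simp: linear_between_def map_of_matrix_def fun_eq_iff sum.distrib[symmetric]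
      sum_distrib_left algebra_simps intro!: sum.cong)

lemma continuous_map_sum_mult_coordinates:
  fixes c :: "'x \<Rightarrow> 'k::topological_field"
  assumes "S \<subseteq> X"
  shows "continuous_map (power_topology X) euclidean (\<lambda>f. \<Sum>x\<in>S. c x * f x)"
proof -
  have "continuous_map (power_topology X) euclidean (\<lambda>f. f x :: 'k)" if "x \<in> S" for x
    using that assms by (intro continuous_map_product_projection) auto
  then show ?thesis
    unfolding continuous_map_atin limitin_canonical_iff
    by (auto intro!: tendsto_sum tendsto_mult tendsto_const)
qed

lemma map_of_matrix_continuous_linear:
  "map_of_matrix X Y (M :: 'y \<times> 'x \<Rightarrow> 'k::topological_field) \<in> continuous_linear_maps X Y"
proof -
  have "continuous_map (power_topology X) (power_topology Y) (map_of_matrix X Y M)"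
    unfolding continuous_map_componentwise
  proof (intro conjI ballI)
    show "map_of_matrix X Y M ` topspace (power_topology X) \<subseteq> extensional Y"
      by (auto simp: map_of_matrix_def)
    fix y assume y: "y \<in> Y"
    let ?S = "{x. x \<in> X \<and> M (y, x) \<noteq> 0}"
    have "continuous_map (power_topology X) euclidean (\<lambda>f. \<Sum>x\<in>?S. M (y, x) * f x)"
      by (rule continuous_map_sum_mult_coordinates) auto
    then show "continuous_map (power_topology X) euclidean (\<lambda>f. map_of_matrix X Y M f y)"
      using y by (elim continuous_map_eq) (simp add: map_of_matrix_def)
  qed
  moreover have "map_of_matrix X Y M \<in> fun_space X \<rightarrow>\<^sub>E fun_space Y"
    by (auto simp: map_of_matrix_def)
  ultimately show ?thesis
    using map_of_matrix_linear by (simp add: continuous_linear_maps_def)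
qed

lemma matrix_of_map_of_matrix:
  assumes M: "M \<in> row_finite_matrices Y X"
  shows "matrix_of_map X Y (map_of_matrix X Y M) = M"
proof (rule PiE_ext[of _ "Y \<times> X" "\<lambda>_. UNIV"])
  show "matrix_of_map X Y (map_of_matrix X Y M) \<in> fun_space (Y \<times> X)"
    by (simp add: matrix_of_map_def)
  show "M \<in> fun_space (Y \<times> X)"
    using M by (simp add: row_finite_matrices_def)
  fix p assume "p \<in> Y \<times> X"
  then obtain y a where p: "p = (y, a)" "y \<in> Y" "a \<in> X" by auto
  let ?S = "{x. x \<in> X \<and> M (y, x) \<noteq> 0}"
  have fin: "finite ?S"
    using M p by (simp add: row_finite_matrices_def)
  have "map_of_matrix X Y M (delta X a) y = (\<Sum>x\<in>?S. M (y, x) * delta X a x)"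
    using p by (simp add: map_of_matrix_def delta_in_fun_space)
  also have "\<dots> = (\<Sum>x\<in>?S. if x = a then M (y, x) else 0)"
    by (intro sum.cong) (auto simp: delta_def)
  also have "\<dots> = M (y, a)"
    using fin p by (simp add: sum.delta)
  finally show "matrix_of_map X Y (map_of_matrix X Y M) p = M p"
    using p by (simp add: matrix_of_map_apply)
qed

theorem theorem14:
  fixes X :: "'x set" and Y :: "'y set"
  shows "(continuous_linear_maps X Y ::
            (('x \<Rightarrow> 'k::{topological_field, t2_space}) \<Rightarrow> ('y \<Rightarrow> 'k)) set)
          \<approx> (row_finite_matrices Y X :: ('y \<times> 'x \<Rightarrow> 'k) set)
    \<and> bij_betw (matrix_of_map X Y)
        (continuous_linear_maps X Y :: (('x \<Rightarrow> 'k) \<Rightarrow> ('y \<Rightarrow> 'k)) set)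
        (row_finite_matrices Y X)"
proof -
  let ?L = "continuous_linear_maps X Y :: (('x \<Rightarrow> 'k) \<Rightarrow> ('y \<Rightarrow> 'k)) set"
  have "matrix_of_map X Y ` ?L = row_finite_matrices Y X"
  proof
    show "matrix_of_map X Y ` ?L \<subseteq> row_finite_matrices Y X"
      using matrix_of_map_row_finite by blast
    show "row_finite_matrices Y X \<subseteq> matrix_of_map X Y ` ?L"
      using matrix_of_map_of_matrix map_of_matrix_continuous_linear
      by (metis image_eqI subsetI)
  qed
  then have "bij_betw (matrix_of_map X Y) ?L (row_finite_matrices Y X)"
    using inj_on_matrix_of_map by (simp add: bij_betw_def)
  then show ?thesis
    unfolding eqpoll_def by blast
qed

end
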